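(* Fix $N\ge1$ and $1\le k\le N-1$. Let $A$ be the set of prefixes $p$ of $\mathrm{Av}_N(321)$ of size $m>k$ with $p|_{[k]}=12\cdots k$ such that (a) $p$ is eligible, (b) $p$ is selected by the threshold, and (c) no $p|_{[j]}$ with $k<j<m$ is selected by the threshold. Then $A$ is an optimal strike set for the game restricted to the open subforest under $12\cdots k$; that is, the strategy that accepts the candidate at the first position $i>k$ with $\pi|_{[i]}\in A$ (accepting the last candidate if no such $i$ exists) achieves the maximal winning probability in that restricted game.
   Context: $\mathrm{Av}_N(321)$ is the set of permutations $\pi=\pi_1\cdots\pi_N$ of $[N]$ with no indices $a<b<c$ such that $\pi_a>\pi_b>\pi_c$. The $i$th prefix flattening $\pi|_{[i]}$ is the permutation of $[i]$ in the same relative order as $\pi_1,\dots,\pi_i$. A prefix of rank $N$ and size $m$ is a permutation $p$ of $[m]$ with $p=\pi|_{[m]}$ for some $\pi\in\mathrm{Av}_N(321)$; it is eligible if $p_m=m$. Restricted game on the open subforest under $12\cdots k$: $\pi$ is uniform among $\pi\in\mathrm{Av}_N(321)$ with $\pi|_{[k]}=12\cdots k$; candidates $1,\dots,k$ are rejected; for $i>k$ the player sees $\pi|_{[i]}$ and, using only prefix flattenings seen so far, accepts or rejects candidate $i$ (candidate $N$ accepted if all earlier rejected); win iff the accepted candidate $i$ has $\pi_i=N$. Let $S_N(12\cdots j)$ be the probability that $\pi_j=N$ for $\pi$ uniform among $\pi\in\mathrm{Av}_N(321)$ with $\pi|_{[j]}=12\cdots j$, and $B^c_N(12\cdots j)$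 the maximal winning probability in the restricted game under $12\cdots j$ (with $B^c_N(12\cdots N)=0$). Call $(N,j)$ optimal if $S_N(12\cdots j)>B^c_N(12\cdots j)$. For $i\ge0$ let $\sigma(i)$ be the minimal $j\ge1$ such that $(j+i,j)$ is optimal ($\sigma(i)=\infty$ if none). The value-saturated left-to-right maxima of a permutation $p$ of $[m]$: their number is the largest $r$ such that each of the values $m,m-1,\dots,m-r+1$ is a left-to-right maximum of $p$ (an entry $p_j$ is a left-to-right maximum if $p_j>p_l$ for all $l<j$). A prefix $p$ of rank $N$ and size $m$ is selected by the threshold if its number of value-saturated left-to-right maxima is at least $\sigma(N-m)$.
   Formalization: Condition (c) is corrected to: no p|_[j] with k<j<m is both eligible and selected by the threshold. As worded it fails, e.g. for N=7, k=4: the ineligible prefix 23451 is selected and blocks all its extensions, giving 35 wins instead of the maximal 39. *)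

theory Defs
  imports
    "HOL-Probability.Probability"
    "HOL-Combinatorics.Multiset_Permutations"
    "HOL-Library.Extended_Nat"
begin

text \<open>
  Permutations of \<open>{1..N}\<close> are lists in one-line notation. Positions are 1-based in the
  mathematics, so \<open>\<pi> ! (i - 1)\<close> is the entry at position \<open>i\<close>.
\<close>

definition Av321 :: "nat \<Rightarrow> nat list set" where
  "Av321 N = {\<pi> \<in> permutations_of_set {1..N}.
     \<not> (\<exists>a b c. a < b \<and> b < c \<and> c < N \<and> \<pi> ! a > \<pi> ! b \<and> \<pi> ! b > \<pi> ! c)}"

text \<open>For a list with distinct entries: replace every entry by its rank among the entries.\<close>

definition flatten :: "nat list \<Rightarrow> nat list" where
  "flatten xs = map (\<lambda>x. card {y \<in> set xs. y \<le> x}) xs"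

definition prefix_flattening :: "nat list \<Rightarrow> nat \<Rightarrow> nat list" where
  "prefix_flattening \<pi> i = flatten (take i \<pi>)"

definition increasing_perm :: "nat \<Rightarrow> nat list" where
  "increasing_perm k = [1..<Suc k]"

definition prefixes :: "nat \<Rightarrow> nat list set" where
  "prefixes N = {prefix_flattening \<pi> m | \<pi> m. \<pi> \<in> Av321 N \<and> 1 \<le> m \<and> m \<le> N}"

definition eligible :: "nat list \<Rightarrow> bool" where
  "eligible p \<longleftrightarrow> p \<noteq> [] \<and> last p = length p"

definition Av321_under :: "nat \<Rightarrow> nat \<Rightarrow> nat list set" where
  "Av321_under N k = {\<pi> \<in> Av321 N. prefix_flattening \<pi> k = increasing_perm k}"

text \<open>
  A strategy decides whether to accept the current candidate, given the list
  \<open>[\<pi>|\<^bsub>[1]\<^esub>, \<dots>, \<pi>|\<^bsub>[i]\<^esub>]\<close> of all prefix flattenings seen so far.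
\<close>

type_synonym strategy = "nat list list \<Rightarrow> bool"

definition history :: "nat list \<Rightarrow> nat \<Rightarrow> nat list list" where
  "history \<pi> i = map (prefix_flattening \<pi>) [1..<Suc i]"

text \<open>The following is only meaningful for \<open>k < N\<close>.\<close>

definition accepted :: "nat \<Rightarrow> nat \<Rightarrow> strategy \<Rightarrow> nat list \<Rightarrow> nat" where
  "accepted N k s \<pi> = (LEAST i. k < i \<and> (s (history \<pi> i) \<or> i = N))"

definition win_prob :: "nat \<Rightarrow> nat \<Rightarrow> strategy \<Rightarrow> real" where
  "win_prob N k s =
     measure_pmf.prob (pmf_of_set (Av321_under N k)) {\<pi>. \<pi> ! (accepted N k s \<pi> - 1) = N}"

definition max_win_prob :: "nat \<Rightarrow> nat \<Rightarrow> real" where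
  "max_win_prob N k = Max (range (win_prob N k))"

definition strike_prob :: "nat \<Rightarrow> nat \<Rightarrow> real" where
  "strike_prob N j =
     measure_pmf.prob (pmf_of_set (Av321_under N j)) {\<pi>. \<pi> ! (j - 1) = N}"

definition closed_best_prob :: "nat \<Rightarrow> nat \<Rightarrow> real" where
  "closed_best_prob N j = (if j = N then 0 else max_win_prob N j)"

definition optimal_pair :: "nat \<Rightarrow> nat \<Rightarrow> bool" where
  "optimal_pair N j \<longleftrightarrow> strike_prob N j > closed_best_prob N j"

definition threshold :: "nat \<Rightarrow> enat" where
  "threshold i =
     (if \<exists>j\<ge>1. optimal_pair (j + i) j
      then enat (LEAST j. 1 \<le> j \<and> optimal_pair (j + i) j) else \<infinity>)"

definition is_ltr_max_value :: "nat list \<Rightarrow> nat \<Rightarrow> bool" where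
  "is_ltr_max_value p v \<longleftrightarrow> (\<exists>j<length p. p ! j = v \<and> (\<forall>l<j. p ! l < p ! j))"

definition num_value_saturated :: "nat list \<Rightarrow> nat" where
  "num_value_saturated p =
     Max {r. r \<le> length p \<and> (\<forall>v\<in>{length p - r<..length p}. is_ltr_max_value p v)}"

definition selected_by_threshold :: "nat \<Rightarrow> nat list \<Rightarrow> bool" where
  "selected_by_threshold N p \<longleftrightarrow> enat (num_value_saturated p) \<ge> threshold (N - length p)"

text \<open>
  Minimality is taken among the eligible selected prefixes. An ineligible prefix can also meet the
  threshold, and it must not rule out its extensions: for \<open>N = 7\<close> and \<open>k = 4\<close> the prefix \<open>23451\<close>
  has 4 value-saturated left-to-right maxima and \<open>threshold 2 = 4\<close>, while \<open>1234\<close> is not selected.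
  Below \<open>23451\<close>, striking at \<open>234516\<close> wins for 9 permutations; without any strike only 5 are won.
\<close>

definition threshold_strike_set :: "nat \<Rightarrow> nat \<Rightarrow> nat list set" where
  "threshold_strike_set N k =
     {p \<in> prefixes N. k < length p \<and> prefix_flattening p k = increasing_perm k
        \<and> eligible p \<and> selected_by_threshold N p
        \<and> (\<forall>j. k < j \<and> j < length p \<longrightarrow>
             \<not> (eligible (prefix_flattening p j)
                \<and> selected_by_threshold N (prefix_flattening p j)))}"

definition strike_strategy :: "nat list set \<Rightarrow> strategy" where
  "strike_strategy A = (\<lambda>h. last h \<in> A)"

definition optimal_strike_set :: "nat \<Rightarrow> nat \<Rightarrow> nat list set \<Rightarrow> bool" where
  "optimal_strike_set N k A \<longleftrightarrow> win_prob N k (strike_strategy A) = max_win_prob N k"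

text \<open>The library operators above are applied to nonempty finite sets only.\<close>

lemma finite_Av321_under: "finite (Av321_under N k)"
  unfolding Av321_under_def Av321_def by simp

lemma increasing_perm_in_Av321_under:
  assumes "k \<le> N"
  shows "increasing_perm N \<in> Av321_under N k"
proof -
  have "take k [1..<Suc N] = [1..<Suc k]"
    using assms by (simp add: take_upt del: upt_Suc)
  moreover have "card {y \<in> set [1..<Suc k]. y \<le> x} = x" if "x \<in> set [1..<Suc k]" for x
  proof -
    have "{y \<in> set [1..<Suc k]. y \<le> x} = {1..x}" using that by auto
    then show ?thesis by simp
  qed
  ultimately have "prefix_flattening (increasing_perm N) k = increasing_perm k"
    unfolding prefix_flattening_def flatten_def increasing_perm_def
    by (simp add: map_idI del: upt_Suc set_upt)
  moreover have "increasing_perm N \<in> Av321 N"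
    unfolding Av321_def increasing_perm_def permutations_of_set_def
    by (auto simp del: upt_Suc)
  ultimately show ?thesis by (simp add: Av321_under_def)
qed

lemma finite_range_win_prob:
  assumes "k \<le> N"
  shows "finite (range (win_prob N k))"
proof -
  let ?A = "Av321_under N k"
  have ne: "?A \<noteq> {}" using increasing_perm_in_Av321_under[OF assms] by blast
  have "range (win_prob N k) \<subseteq> (\<lambda>n. real n / real (card ?A)) ` {..card ?A}"
    unfolding win_prob_def
    by (auto simp: measure_pmf_of_set[OF ne finite_Av321_under]
        intro!: imageI card_mono finite_Av321_under)
  then show ?thesis by (rule finite_subset) simp
qed

lemma win_prob_le_max_win_prob: "k \<le> N \<Longrightarrow> win_prob N k s \<le> max_win_prob N k"
  unfolding max_win_prob_def by (simp add: finite_range_win_prob)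

end

theory Submission
  imports Defs
begin

text \<open>
  Appending a new last value to a 321-avoiding prefix with \<open>r\<close> value-saturated left-to-right maxima
  keeps it 321-avoiding iff the value exceeds all values that are not value-saturated. The new
  prefix is eligible with parameter \<open>r + 1\<close>, or it is ineligible with parameter \<open>j\<close> for exactly one
  choice of each \<open>j = 1, \<dots>, r\<close>. Hence everything below a prefix depends only on \<open>r\<close> and on the number
  \<open>n\<close> of remaining candidates. For an eligible prefix let \<open>g n r\<close> be the number of extensions won by
  striking and \<open>b n r\<close> the maximal number won by continuing:
  \<open>g (n+1) r = (\<Sum>j=1..r. g n j)\<close> and
  \<open>b (n+1) r = max (g n (r+1)) (b n (r+1)) + (\<Sum>j=1..r. b n j)\<close>. By induction on \<open>n\<close> the ratio
  \<open>b n r / g n r\<close> is nonincreasing in \<open>r\<close>, so striking beats continuing exactly from some threshold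
  in \<open>r\<close> on. The prefix \<open>12\<cdots>j\<close> has parameter \<open>j\<close>, hence this threshold is \<open>\<sigma>(n)\<close>.
\<close>

section \<open>Counting in the generating tree\<close>

text \<open>
  \<open>stay_count\<close> and \<open>best_count\<close> are the functions \<open>g\<close> and \<open>b\<close> above; \<open>g n r\<close> counts the paths of
  length \<open>n\<close> from parameter \<open>r\<close> that never create a new maximum.
\<close>

fun stay_count :: "nat \<Rightarrow> nat \<Rightarrow> nat" where
  "stay_count 0 r = 1"
| "stay_count (Suc n) r = (\<Sum>j=1..r. stay_count n j)"

fun best_count :: "nat \<Rightarrow> nat \<Rightarrow> nat" where
  "best_count 0 r = 0"
| "best_count (Suc n) r =
     max (stay_count n (Suc r)) (best_count n (Suc r)) + (\<Sum>j=1..r. best_count n j)"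

declare stay_count.simps(2) [simp del] best_count.simps(2) [simp del]

lemma stay_count_pos: "1 \<le> r \<Longrightarrow> 0 < stay_count n r"
proof (induction n arbitrary: r)
  case (Suc n)
  have "0 < stay_count n 1" using Suc.IH[of 1] by simp
  also have "\<dots> \<le> (\<Sum>j=1..r. stay_count n j)"
    using Suc.prems by (intro member_le_sum) auto
  finally show ?case by (simp add: stay_count.simps)
qed simp

text \<open>For \<open>r\<close> at least 1, \<open>stay_count n r\<close> is the binomial
  coefficient C(n+r-1, n), and this is its absorption identity. It is obtained straight from the
  recursion, by an outer induction on \<open>n\<close> and an inner one on \<open>r\<close>. It
  trades one remaining candidate for one unit of the parameter, which is how the top child enters
  \<open>best_count\<close>.\<close>

lemma stay_count_Suc_mult: "Suc n * stay_count (Suc n) r = r * stay_count n (Suc r)"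
proof (induction n arbitrary: r)
  case (Suc n)
  \<comment> \<open>The outer hypothesis at \<open>Suc r\<close>, with
    \<open>Suc r * stay_count (Suc n) (Suc r)\<close> added to both sides; on the right the
    recursion merges the two summands.\<close>
  have shift: "(Suc n + Suc r) * stay_count (Suc n) (Suc r)
      = Suc r * stay_count (Suc n) (Suc (Suc r))" for r
    using Suc.IH[of "Suc r"] by (simp add: algebra_simps stay_count.simps(2))
  show ?case
  proof (induction r)
    case (Suc r)
    then show ?case using shift[of r] by (simp add: algebra_simps stay_count.simps(2))
  qed (simp add: stay_count.simps)
qed (simp add: stay_count.simps)

text \<open>The cross-multiplied hypothesis says that f/g is nonincreasing; the same then holds for
  the ratio of partial sums. After splitting off the tail beyond \<open>r\<close>, the product of
  the two heads is common to both sides, and each tail-head pair is compared by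
  \<open>cross\<close>.\<close>

lemma sum_cross_le:
  fixes f g :: "nat \<Rightarrow> nat"
  assumes cross: "\<And>i j. 1 \<le> i \<Longrightarrow> i \<le> j \<Longrightarrow> f j * g i \<le> f i * g j" and "r \<le> r'"
  shows "(\<Sum>j=1..r'. f j) * (\<Sum>i=1..r. g i) \<le> (\<Sum>j=1..r. f j) * (\<Sum>i=1..r'. g i)"
proof -
  have split: "(\<Sum>j=1..r'. h j) = (\<Sum>j=1..r. h j) + (\<Sum>j\<in>{r<..r'}. h j)"
    for h :: "nat \<Rightarrow> nat"
  proof -
    have "{1..r'} = {1..r} \<union> {r<..r'}" using \<open>r \<le> r'\<close> by auto
    then show ?thesis by (simp add: sum.union_disjoint disjoint_iff)
  qed
  have "(\<Sum>j\<in>{r<..r'}. f j) * (\<Sum>i=1..r. g i) = (\<Sum>j\<in>{r<..r'}. \<Sum>i=1..r. f j * g i)"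
    by (simp add: sum_product)
  also have "\<dots> \<le> (\<Sum>j\<in>{r<..r'}. \<Sum>i=1..r. f i * g j)"
    by (intro sum_mono cross) auto
  also have "\<dots> = (\<Sum>j=1..r. f j) * (\<Sum>i\<in>{r<..r'}. g i)"
    by (subst sum.swap) (simp add: sum_product)
  finally show ?thesis by (simp only: split distrib_left distrib_right)
qed

text \<open>The ratio \<open>best_count n r / stay_count n r\<close> is nonincreasing in
  \<open>r\<close>, stated without division. The two summands of the recursion are compared
  separately: the top child by the absorption identity, the others by
  \<open>sum_cross_le\<close>.\<close>

lemma best_count_cross_le:
  "1 \<le> r \<Longrightarrow> r \<le> r' \<Longrightarrow>
   best_count n r' * stay_count n r \<le> best_count n r * stay_count n r'"
proof (induction n arbitrary: r r')
  case (Suc n)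
  let ?g = "stay_count n" and ?G = "stay_count (Suc n)"
  let ?M = "\<lambda>r. max (?g r) (best_count n r)"
  \<comment> \<open>Cross-multiplying distributes over the maximum: the striking branch gives an
    equality, the continuing branch is the induction hypothesis at \<open>Suc r\<close> and
    \<open>Suc r'\<close>.\<close>
  have "?M (Suc r') * ?g (Suc r) \<le> ?M (Suc r) * ?g (Suc r')"
    unfolding nat_mult_max_left
    using Suc.IH[of "Suc r" "Suc r'"] Suc.prems by (intro max.mono) (auto simp: mult.commute)
  \<comment> \<open>The factors \<open>r\<close> and \<open>r'\<close> are those by which
    \<open>stay_count_Suc_mult\<close> turns \<open>?g (Suc r)\<close> and
    \<open>?g (Suc r')\<close> into multiples of \<open>?G r\<close> and
    \<open>?G r'\<close>.\<close>
  then have "r * (?M (Suc r') * ?g (Suc r)) \<le> r' * (?M (Suc r) * ?g (Suc r'))"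
    using Suc.prems(2) by (intro mult_mono[of r r']) simp_all
  then have "?M (Suc r') * (Suc n * ?G r) \<le> ?M (Suc r) * (Suc n * ?G r')"
    unfolding stay_count_Suc_mult by (simp only: ac_simps)
  then have "Suc n * (?M (Suc r') * ?G r) \<le> Suc n * (?M (Suc r) * ?G r')"
    by (simp only: ac_simps)
  then have top: "?M (Suc r') * ?G r \<le> ?M (Suc r) * ?G r'"
    by (simp only: Suc_mult_le_cancel1)
  have "(\<Sum>j=1..r'. best_count n j) * ?G r \<le> (\<Sum>j=1..r. best_count n j) * ?G r'"
    unfolding stay_count.simps using Suc.prems Suc.IH by (intro sum_cross_le) auto
  with top show ?case
    unfolding best_count.simps distrib_right by (rule add_mono)
qed simp

text \<open>A nonincreasing ratio that is below 1 stays below 1. This is what makes a single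
  threshold in \<open>r\<close> sufficient.\<close>

lemma stay_beats_best_mono:
  assumes "1 \<le> r" "r \<le> r'" "best_count n r < stay_count n r"
  shows "best_count n r' < stay_count n r'"
proof -
  have "best_count n r' * stay_count n r \<le> best_count n r * stay_count n r'"
    using assms by (intro best_count_cross_le)
  also have "\<dots> < stay_count n r * stay_count n r'"
    using assms stay_count_pos[of r' n] by simp
  finally show ?thesis by (simp add: mult.commute)
qed

section \<open>Flattening and appending values\<close>

lemma length_flatten [simp]: "length (flatten xs) = length xs"
  by (simp add: flatten_def)

lemma strict_mono_on_rank:
  "finite A \<Longrightarrow> strict_mono_on A (\<lambda>x::nat. card {y \<in> A. y \<le> x})"
proof (intro strict_mono_onI psubset_card_mono)
  fix x y assume "x \<in> A" "y \<in> A" "x < y"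
  then have "y \<in> {z \<in> A. z \<le> y} - {z \<in> A. z \<le> x}" by simp
  then show "{z \<in> A. z \<le> x} \<subset> {z \<in> A. z \<le> y}" using \<open>x < y\<close> by fastforce
qed simp

text \<open>Ranks depend only on relative order. The lemma is used for two relabellings: the rank
  map of a longer prefix, and the shift of values in \<open>append_value\<close>.\<close>

lemma flatten_map_strict_mono:
  assumes "strict_mono_on (set xs) f"
  shows "flatten (map f xs) = flatten xs"
proof -
  have "{y \<in> f ` set xs. y \<le> f x} = f ` {y \<in> set xs. y \<le> x}" if "x \<in> set xs" for x
    using strict_mono_on_leD[OF assms] strict_mono_on_less[OF assms] that
    by (auto simp: not_le[symmetric])
  moreover have "inj_on f {y \<in> set xs. y \<le> x}" for x
    using strict_mono_on_imp_inj_on[OF assms] by (rule inj_on_subset) auto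
  ultimately show ?thesis
    by (simp add: flatten_def card_image)
qed

lemma prefix_flattening_prefix_flattening:
  "j \<le> i \<Longrightarrow> prefix_flattening (prefix_flattening xs i) j = prefix_flattening xs j"
proof -
  assume "j \<le> i"
  let ?f = "\<lambda>x. card {y \<in> set (take i xs). y \<le> x}"
  have "strict_mono_on (set (take j (take i xs))) ?f"
    by (rule monotone_on_subset[OF strict_mono_on_rank set_take_subset]) simp
  from flatten_map_strict_mono[OF this] \<open>j \<le> i\<close> show ?thesis
    by (simp add: prefix_flattening_def flatten_def[of "take i xs"] take_map min_absorb1)
qed

lemma flatten_perm:
  assumes "xs \<in> permutations_of_set {1..m}"
  shows "flatten xs = xs"
proof -
  have "card {y \<in> set xs. y \<le> x} = x" if "x \<in> set xs" for x
  proof -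
    have "{y \<in> set xs. y \<le> x} = {1..x}"
      using assms that by (auto simp: permutations_of_set_def)
    then show ?thesis by simp
  qed
  then show ?thesis by (simp add: flatten_def map_idI)
qed

lemma flatten_in_permutations:
  assumes "distinct xs"
  shows "flatten xs \<in> permutations_of_set {1..length xs}"
proof -
  have d: "distinct (flatten xs)"
    using assms strict_mono_on_imp_inj_on[OF strict_mono_on_rank[of "set xs"]]
    by (simp add: flatten_def distinct_map)
  have "set (flatten xs) \<subseteq> {1..length xs}"
  proof
    fix v assume "v \<in> set (flatten xs)"
    then obtain x where x: "x \<in> set xs" "v = card {y \<in> set xs. y \<le> x}"
      by (auto simp: flatten_def)
    then have "v \<le> card (set xs)" "v \<noteq> 0" by (auto intro: card_mono)
    then show "v \<in> {1..length xs}" using assms by (simp add: distinct_card)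
  qed
  moreover have "card (set (flatten xs)) = length xs"
    using d by (simp add: distinct_card)
  ultimately have "set (flatten xs) = {1..length xs}"
    by (intro card_subset_eq) auto
  with d show ?thesis by (simp add: permutations_of_set_def)
qed

lemma Av321_perm: "p \<in> Av321 m \<Longrightarrow> p \<in> permutations_of_set {1..m}"
  by (simp add: Av321_def)

lemma length_perm: "p \<in> permutations_of_set {1..m} \<Longrightarrow> length p = m"
  by (metis length_finite_permutations_of_set card_atLeastAtMost diff_Suc_1)

lemma Av321_length: "p \<in> Av321 m \<Longrightarrow> length p = m"
  using length_perm Av321_perm by blast

lemma flatten_nth_less_iff:
  assumes "i < length xs" "j < length xs"
  shows "flatten xs ! i < flatten xs ! j \<longleftrightarrow> xs ! i < xs ! j"
  using strict_mono_on_less[OF strict_mono_on_rank[of "set xs"], of "xs ! i" "xs ! j"] assms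
  by (simp add: flatten_def)

lemma prefix_flattening_Av321:
  assumes "\<pi> \<in> Av321 N" "m \<le> N"
  shows "prefix_flattening \<pi> m \<in> Av321 m"
proof -
  have l: "length (take m \<pi>) = m" using assms Av321_length by auto
  have "distinct (take m \<pi>)"
    using Av321_perm[OF assms(1)] by (simp add: permutations_of_set_def)
  from flatten_in_permutations[OF this] have "flatten (take m \<pi>) \<in> permutations_of_set {1..m}"
    by (simp only: l)
  moreover have "\<not> (flatten (take m \<pi>) ! a > flatten (take m \<pi>) ! b
      \<and> flatten (take m \<pi>) ! b > flatten (take m \<pi>) ! c)"
    if "a < b" "b < c" "c < m" for a b c
    using that assms l by (auto simp: flatten_nth_less_iff Av321_def)
  ultimately show ?thesis by (auto simp: Av321_def prefix_flattening_def)
qed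

lemma prefix_flattening_self: "p \<in> Av321 m \<Longrightarrow> prefix_flattening p m = p"
  using flatten_perm[OF Av321_perm] Av321_length by (simp add: prefix_flattening_def)

section \<open>Children in the generating tree: appending a last value\<close>

definition append_value :: "nat list \<Rightarrow> nat \<Rightarrow> nat list" where
  "append_value p v = map (\<lambda>x. if v \<le> x then Suc x else x) p @ [v]"

lemma length_append_value [simp]: "length (append_value p v) = Suc (length p)"
  by (simp add: append_value_def)

lemma append_value_nth:
  "i < length p \<Longrightarrow> append_value p v ! i = (if v \<le> p ! i then Suc (p ! i) else p ! i)"
  by (simp add: append_value_def nth_append)

lemma append_value_nth_length [simp]: "append_value p v ! length p = v"
  by (simp add: append_value_def nth_append)

lemma last_append_value [simp]: "last (append_value p v) = v"
  by (simp add: append_value_def)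

lemma append_value_nth_less_iff:
  "i < length p \<Longrightarrow> j < length p \<Longrightarrow>
   append_value p v ! i < append_value p v ! j \<longleftrightarrow> p ! i < p ! j"
  by (auto simp: append_value_nth)

lemma prefix_flattening_append_value:
  assumes "p \<in> Av321 m"
  shows "prefix_flattening (append_value p v) m = p"
proof -
  have "strict_mono_on (set p) (\<lambda>x. if v \<le> x then Suc x else x)"
    by (auto intro: strict_mono_onI)
  from flatten_map_strict_mono[OF this] show ?thesis
    using flatten_perm[OF Av321_perm[OF assms]] Av321_length[OF assms]
    by (simp add: prefix_flattening_def append_value_def)
qed

lemma append_value_perm:
  assumes "p \<in> permutations_of_set {1..m}" "1 \<le> v" "v \<le> Suc m"
  shows "append_value p v \<in> permutations_of_set {1..Suc m}"
proof -
  have s: "set p = {1..m}" "distinct p" using assms by (auto simp: permutations_of_set_def)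
  let ?f = "\<lambda>x. if v \<le> x then Suc x else x"
  have "?f ` {1..m} = {1..Suc m} - {v}"
  proof (intro equalityI subsetI)
    fix y assume y: "y \<in> {1..Suc m} - {v}"
    show "y \<in> ?f ` {1..m}"
    proof (cases "y < v")
      case True
      then show ?thesis using y assms by (intro image_eqI[of _ _ y]) auto
    next
      case False
      then show ?thesis using y assms by (intro image_eqI[of _ _ "y - 1"]) auto
    qed
  qed (use assms in \<open>auto split: if_splits\<close>)
  moreover have "inj_on ?f {1..m}" by (auto simp: inj_on_def split: if_splits)
  ultimately show ?thesis
    using s assms by (auto simp: permutations_of_set_def append_value_def distinct_map)
qed

text \<open>Dropping the last entry lowers exactly the larger values by one, and
  \<open>append_value\<close> raises them again. Hence every permutation is the child of its own
  prefix flattening.\<close>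

lemma append_value_prefix_flattening:
  assumes "q \<in> permutations_of_set {1..Suc m}"
  shows "append_value (prefix_flattening q m) (last q) = q"
proof -
  have l: "length q = Suc m" using length_perm[OF assms] .
  obtain xs v where q: "q = xs @ [v]" using l by (cases q rule: rev_cases) auto
  have lx: "length xs = m" using l q by simp
  have s: "insert v (set xs) = {1..Suc m}" "v \<notin> set xs" "distinct xs"
    using assms q by (auto simp: permutations_of_set_def)
  have sx: "set xs = {1..Suc m} - {v}" unfolding s(1)[symmetric] using s(2) by simp
  have "v \<in> {1..Suc m}" unfolding s(1)[symmetric] by simp
  then have v: "1 \<le> v" "v \<le> Suc m" by auto
  have "(let y = card {y \<in> set xs. y \<le> x} in if v \<le> y then Suc y else y) = x"
    if "x \<in> set xs" for x
  proof (cases "x < v")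
    case True
    then have "{y \<in> set xs. y \<le> x} = {1..x}" unfolding sx using v(2) by auto
    then show ?thesis using True by simp
  next
    case False
    then have "v < x" "x \<le> Suc m" using that unfolding sx by simp_all
    then have "{y \<in> set xs. y \<le> x} = {1..x} - {v}" unfolding sx by auto
    then have "card {y \<in> set xs. y \<le> x} = x - 1" using v \<open>v < x\<close> by (simp add: card_Diff_singleton)
    then show ?thesis using \<open>v < x\<close> by (auto simp: Let_def)
  qed
  then show ?thesis
    by (simp add: q lx append_value_def prefix_flattening_def flatten_def map_idI Let_def)
qed

section \<open>Value-saturated left-to-right maxima\<close>

text \<open>The admissible values of \<open>r\<close> form an initial segment, so a single failure
  at the next value down determines the maximum.\<close>

lemma num_value_saturated_eqI:
  assumes "r \<le> length p" "\<And>v. length p - r < v \<Longrightarrow> v \<le> length p \<Longrightarrow> is_ltr_max_value p v"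
    and "r < length p \<Longrightarrow> \<not> is_ltr_max_value p (length p - r)"
  shows "num_value_saturated p = r"
  unfolding num_value_saturated_def
proof (rule Max_eqI)
  fix y assume y: "y \<in> {r. r \<le> length p \<and> (\<forall>v\<in>{length p - r<..length p}. is_ltr_max_value p v)}"
  show "y \<le> r"
  proof (rule ccontr)
    assume "\<not> y \<le> r"
    then have "r < length p" "length p - r \<in> {length p - y<..length p}" using y by auto
    then show False using y assms(3) by blast
  qed
qed (use assms in auto)

lemma num_value_saturated_props:
  shows num_value_saturated_le: "num_value_saturated p \<le> length p"
    and num_value_saturated_ltr: "\<And>v. length p - num_value_saturated p < v \<Longrightarrow> v \<le> length p
      \<Longrightarrow> is_ltr_max_value p v"
    and num_value_saturated_max: "num_value_saturated p < length p \<Longrightarrow>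
      \<not> is_ltr_max_value p (length p - num_value_saturated p)"
proof -
  let ?S = "{r. r \<le> length p \<and> (\<forall>v\<in>{length p - r<..length p}. is_ltr_max_value p v)}"
  have fin: "finite ?S" by (rule finite_subset[of _ "{..length p}"]) auto
  have "0 \<in> ?S" by simp
  then have mem: "num_value_saturated p \<in> ?S"
    unfolding num_value_saturated_def by (intro Max_in fin) blast
  then show "num_value_saturated p \<le> length p"
    and ltr: "\<And>v. length p - num_value_saturated p < v \<Longrightarrow> v \<le> length p \<Longrightarrow> is_ltr_max_value p v"
    by auto
  show "\<not> is_ltr_max_value p (length p - num_value_saturated p)"
    if lt: "num_value_saturated p < length p"
  proof
    assume last: "is_ltr_max_value p (length p - num_value_saturated p)"
    have "is_ltr_max_value p v" if "v \<in> {length p - Suc (num_value_saturated p)<..length p}" for v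
      using that last ltr[of v] lt by (cases "v = length p - num_value_saturated p") auto
    then have "Suc (num_value_saturated p) \<in> ?S" using lt by simp
    then have "Suc (num_value_saturated p) \<le> num_value_saturated p"
      unfolding num_value_saturated_def by (intro Max_ge fin)
    then show False by simp
  qed
qed

lemma is_ltr_max_value_nth:
  assumes "p \<in> permutations_of_set {1..m}" "b < m"
  shows "is_ltr_max_value p (p ! b) \<longleftrightarrow> (\<forall>a<b. p ! a < p ! b)"
proof -
  have "distinct p" "length p = m"
    using assms length_perm by (auto simp: permutations_of_set_def)
  then show ?thesis
    using assms by (auto simp: is_ltr_max_value_def nth_eq_iff_index_eq)
qed

lemma perm_value_obtain:
  assumes "p \<in> permutations_of_set {1..m}" "1 \<le> w" "w \<le> m"
  obtains b where "b < m" "p ! b = w"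
proof -
  have "w \<in> set p" using assms by (auto simp: permutations_of_set_def)
  then show ?thesis using that length_perm[OF assms(1)] by (auto simp: in_set_conv_nth)
qed

lemma perm_nth_bounds:
  assumes "p \<in> permutations_of_set {1..m}" "b < m"
  shows "1 \<le> p ! b" "p ! b \<le> m"
proof -
  have "p ! b \<in> set p" using assms length_perm by auto
  then show "1 \<le> p ! b" "p ! b \<le> m" using assms by (auto simp: permutations_of_set_def)
qed

text \<open>The new entry stands last, so it cannot affect whether an earlier entry is a
  left-to-right maximum; only the names of the values at or above \<open>v\<close> change. The new
  entry itself exceeds all others only if it is the top value.\<close>

lemma is_ltr_max_value_append_value:
  assumes "p \<in> permutations_of_set {1..m}" "1 \<le> v" "v \<le> Suc m" "1 \<le> w" "w \<le> Suc m"
  shows "is_ltr_max_value (append_value p v) w \<longleftrightarrow>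
    (if w < v then is_ltr_max_value p w
     else if w = v then v = Suc m else is_ltr_max_value p (w - 1))"
proof -
  have l: "length p = m" using length_perm[OF assms(1)] .
  have q: "append_value p v \<in> permutations_of_set {1..Suc m}"
    using assms by (intro append_value_perm)
  show ?thesis
  proof (cases "w = v")
    case True
    have "is_ltr_max_value (append_value p v) v \<longleftrightarrow> (\<forall>a<m. append_value p v ! a < v)"
      using is_ltr_max_value_nth[OF q, of m] l append_value_nth_length[of p v] by simp
    also have "\<dots> \<longleftrightarrow> (\<forall>a<m. p ! a < v)"
      using l by (simp add: append_value_nth) (meson Suc_leD leD not_less)
    also have "\<dots> \<longleftrightarrow> v = Suc m"
    proof
      assume *: "\<forall>a<m. p ! a < v"
      show "v = Suc m"
      proof (rule ccontr)
        assume "v \<noteq> Suc m"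
        then obtain b where "b < m" "p ! b = v"
          using perm_value_obtain[OF assms(1), of v] assms by auto
        with * show False by auto
      qed
    next
      assume "v = Suc m"
      then show "\<forall>a<m. p ! a < v" using perm_nth_bounds[OF assms(1)] by (simp add: less_Suc_eq_le)
    qed
    finally show ?thesis using True by simp
  next
    case False
    \<comment> \<open>The value that the entry now called \<open>w\<close> had before the
      shift.\<close>
    define u where "u = (if w < v then w else w - 1)"
    have "1 \<le> u" "u \<le> m" using False assms by (auto simp: u_def)
    then obtain b where b: "b < m" "p ! b = u" using perm_value_obtain[OF assms(1)] by blast
    then have qb: "append_value p v ! b = w"
      using False l assms by (auto simp: append_value_nth u_def)
    have "is_ltr_max_value (append_value p v) w \<longleftrightarrow> is_ltr_max_value p u"
      using is_ltr_max_value_nth[OF q, of b] is_ltr_max_value_nth[OF assms(1), of b] b qb l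
        append_value_nth_less_iff[of _ p b v] by auto
    then show ?thesis using False by (simp add: u_def)
  qed
qed

text \<open>A new 321 pattern must end in the appended entry, so its middle entry is a value at
  least \<open>v\<close> that is not a left-to-right maximum. Avoidance thus means that the values
  from \<open>v\<close> to \<open>m\<close> all lie in the saturated block.\<close>

lemma append_value_Av321_iff:
  assumes p: "p \<in> Av321 m" and v: "1 \<le> v" "v \<le> Suc m"
  shows "append_value p v \<in> Av321 (Suc m) \<longleftrightarrow> Suc m - num_value_saturated p \<le> v"
proof -
  note perm = Av321_perm[OF p]
  have l: "length p = m" using Av321_length[OF p] .
  let ?q = "append_value p v"
  have old: "\<not> (?q ! a > ?q ! b \<and> ?q ! b > ?q ! c)" if "a < b" "b < c" "c < m" for a b c
    using that p l by (simp add: append_value_nth_less_iff Av321_def)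
  \<comment> \<open>Strict on the left and weak on the right: an old entry equal to \<open>v\<close>
    is pushed above the new one.\<close>
  have gt: "v < ?q ! b \<longleftrightarrow> v \<le> p ! b" if "b < m" for b
    using that l by (auto simp: append_value_nth)
  have qm: "?q ! m = v" using l append_value_nth_length by metis
  have "?q \<in> Av321 (Suc m) \<longleftrightarrow> \<not> (\<exists>a b. a < b \<and> b < m \<and> p ! a > p ! b \<and> v \<le> p ! b)"
  proof
    assume *: "?q \<in> Av321 (Suc m)"
    show "\<not> (\<exists>a b. a < b \<and> b < m \<and> p ! a > p ! b \<and> v \<le> p ! b)"
    proof
      assume "\<exists>a b. a < b \<and> b < m \<and> p ! a > p ! b \<and> v \<le> p ! b"
      then obtain a b where ab: "a < b" "b < m" "p ! a > p ! b" "v \<le> p ! b" by blast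
      then have "?q ! a > ?q ! b" "?q ! b > ?q ! m"
        using l gt qm by (auto simp: append_value_nth_less_iff)
      with ab * show False by (auto simp: Av321_def)
    qed
  next
    assume *: "\<not> (\<exists>a b. a < b \<and> b < m \<and> p ! a > p ! b \<and> v \<le> p ! b)"
    have "\<not> (?q ! a > ?q ! b \<and> ?q ! b > ?q ! c)" if abc: "a < b" "b < c" "c < Suc m" for a b c
    proof (cases "c = m")
      case True
      with abc have "a < m" "b < m" by auto
      with True * abc show ?thesis
        using gt[of b] qm l append_value_nth_less_iff[of b p a v] by auto
    next
      case False
      with abc show ?thesis by (intro old) auto
    qed
    then show "?q \<in> Av321 (Suc m)" using append_value_perm[OF perm v] by (auto simp: Av321_def)
  qed
  also have "\<dots> \<longleftrightarrow> (\<forall>b<m. v \<le> p ! b \<longrightarrow> is_ltr_max_value p (p ! b))"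
  proof -
    have "distinct p" using perm by (simp add: permutations_of_set_def)
    then have "p ! a \<noteq> p ! b" if "a < b" "b < m" for a b
      using that l by (simp add: nth_eq_iff_index_eq)
    then show ?thesis
      using is_ltr_max_value_nth[OF perm] by (metis linorder_neqE_nat not_less_iff_gr_or_eq)
  qed
  also have "\<dots> \<longleftrightarrow> (\<forall>w\<in>{v..m}. is_ltr_max_value p w)"
    using perm_value_obtain[OF perm] perm_nth_bounds[OF perm] v
    by (metis atLeastAtMost_iff order_trans)
  also have "\<dots> \<longleftrightarrow> Suc m - num_value_saturated p \<le> v"
  proof
    assume *: "\<forall>w\<in>{v..m}. is_ltr_max_value p w"
    show "Suc m - num_value_saturated p \<le> v"
    proof (rule ccontr)
      assume "\<not> ?thesis"
      then show False
        using num_value_saturated_max[of p] l v * by force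
    qed
  qed (use num_value_saturated_ltr[of p] num_value_saturated_le[of p] l in auto)
  finally show ?thesis .
qed

text \<open>The new top value extends the saturated block by one, and the old value that ended the
  block still ends it.\<close>

lemma num_value_saturated_append_top:
  assumes p: "p \<in> Av321 m"
  shows "num_value_saturated (append_value p (Suc m)) = Suc (num_value_saturated p)"
proof -
  note L = is_ltr_max_value_append_value[OF Av321_perm[OF p], of "Suc m"]
  have l: "length p = m" using Av321_length[OF p] .
  show ?thesis
  proof (rule num_value_saturated_eqI)
    fix w assume w: "length (append_value p (Suc m)) - Suc (num_value_saturated p) < w"
      "w \<le> length (append_value p (Suc m))"
    then show "is_ltr_max_value (append_value p (Suc m)) w"
      using num_value_saturated_ltr[of p w] l by (subst L) auto
  next
    assume "Suc (num_value_saturated p) < length (append_value p (Suc m))"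
    then show "\<not> is_ltr_max_value (append_value p (Suc m))
        (length (append_value p (Suc m)) - Suc (num_value_saturated p))"
      using num_value_saturated_max[of p] l by (subst L) auto
  qed (use num_value_saturated_le[of p] in auto)
qed

text \<open>Exactly \<open>j\<close> values lie above the appended one. They are shifted saturated
  values and remain left-to-right maxima, while the appended value is not one and ends the
  block.\<close>

lemma num_value_saturated_append_below:
  assumes p: "p \<in> Av321 m" and j: "1 \<le> j" "j \<le> num_value_saturated p"
  shows "num_value_saturated (append_value p (Suc m - j)) = j"
proof -
  have l: "length p = m" using Av321_length[OF p] .
  have jm: "j \<le> m" using num_value_saturated_le[of p] j l by simp
  note L = is_ltr_max_value_append_value[OF Av321_perm[OF p], of "Suc m - j"]
  show ?thesis
  proof (rule num_value_saturated_eqI)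
    fix w assume w: "length (append_value p (Suc m - j)) - j < w"
      "w \<le> length (append_value p (Suc m - j))"
    then show "is_ltr_max_value (append_value p (Suc m - j)) w"
      using num_value_saturated_ltr[of p "w - 1"] l j jm by (subst L) auto
  next
    assume "j < length (append_value p (Suc m - j))"
    show "\<not> is_ltr_max_value (append_value p (Suc m - j))
        (length (append_value p (Suc m - j)) - j)"
      using j jm l by (subst L) auto
  qed (use jm l in auto)
qed

section \<open>Counting wins below a prefix\<close>

definition extensions :: "nat \<Rightarrow> nat list \<Rightarrow> nat list set" where
  "extensions N p = {\<pi> \<in> Av321 N. prefix_flattening \<pi> (length p) = p}"

lemma finite_extensions [simp]: "finite (extensions N p)"
  by (auto simp: extensions_def Av321_def)

lemma append_value_inj: "append_value p v = append_value p w \<Longrightarrow> v = w"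
  by (metis last_append_value)

lemma extensions_split:
  assumes p: "p \<in> Av321 m" and "m < N"
  shows "extensions N p =
    (\<Union>v\<in>{Suc m - num_value_saturated p..Suc m}. extensions N (append_value p v))"
proof (intro equalityI subsetI)
  fix \<pi> assume \<pi>: "\<pi> \<in> extensions N p"
  let ?q = "prefix_flattening \<pi> (Suc m)"
  have q: "?q \<in> Av321 (Suc m)"
    using \<pi> \<open>m < N\<close> by (intro prefix_flattening_Av321) (auto simp: extensions_def)
  have "prefix_flattening ?q m = p"
    using \<pi> Av321_length[OF p] by (simp add: prefix_flattening_prefix_flattening extensions_def)
  with append_value_prefix_flattening[OF Av321_perm[OF q]]
  have eq: "append_value p (last ?q) = ?q" by simp
  have "last ?q \<in> set ?q" using Av321_length[OF q] by (intro last_in_set) auto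
  then have "1 \<le> last ?q" "last ?q \<le> Suc m"
    using Av321_perm[OF q] by (auto simp: permutations_of_set_def)
  then have "last ?q \<in> {Suc m - num_value_saturated p..Suc m}"
    using append_value_Av321_iff[OF p, of "last ?q"] q eq by simp
  moreover have "\<pi> \<in> extensions N (append_value p (last ?q))"
    using \<pi> eq Av321_length[OF q] by (simp add: extensions_def)
  ultimately show "\<pi> \<in> (\<Union>v\<in>{Suc m - num_value_saturated p..Suc m}. extensions N (append_value p v))"
    by blast
next
  fix \<pi> assume "\<pi> \<in> (\<Union>v\<in>{Suc m - num_value_saturated p..Suc m}. extensions N (append_value p v))"
  then obtain v where "\<pi> \<in> Av321 N" "prefix_flattening \<pi> (Suc m) = append_value p v"
    using Av321_length[OF p] by (auto simp: extensions_def)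
  then show "\<pi> \<in> extensions N p"
    using prefix_flattening_append_value[OF p, of v] Av321_length[OF p]
      prefix_flattening_prefix_flattening[of m "Suc m" \<pi>]
    by (simp add: extensions_def)
qed

text \<open>The last entry of a child determines \<open>v\<close>, so the classes are disjoint. The
  index \<open>j = Suc m - v\<close> is the parameter of the child for \<open>j\<close> at least 1;
  \<open>j = 0\<close> is the top child.\<close>

lemma card_extensions_split:
  assumes p: "p \<in> Av321 m" and "m < N"
  shows "card {\<pi> \<in> extensions N p. P \<pi>} =
    card {\<pi> \<in> extensions N (append_value p (Suc m)). P \<pi>} +
    (\<Sum>j=1..num_value_saturated p. card {\<pi> \<in> extensions N (append_value p (Suc m - j)). P \<pi>})"
proof -
  let ?r = "num_value_saturated p"
  let ?C = "\<lambda>v. {\<pi> \<in> extensions N (append_value p v). P \<pi>}"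
  have rm: "?r \<le> m" using num_value_saturated_le[of p] Av321_length[OF p] by simp
  have "{\<pi> \<in> extensions N p. P \<pi>} = (\<Union>v\<in>{Suc m - ?r..Suc m}. ?C v)"
    using extensions_split[OF assms] by blast
  also have "card \<dots> = (\<Sum>v=Suc m - ?r..Suc m. card (?C v))"
  proof (intro card_UN_disjoint ballI impI)
    fix v w :: nat assume "v \<noteq> w"
    then show "?C v \<inter> ?C w = {}" by (auto simp: extensions_def dest: append_value_inj)
  qed auto
  also have "\<dots> = (\<Sum>j=0..?r. card (?C (Suc m - j)))"
    by (rule sum.reindex_bij_witness[where i = "\<lambda>j. Suc m - j" and j = "\<lambda>v. Suc m - v"])
      (use rm in auto)
  also have "\<dots> = card (?C (Suc m)) + (\<Sum>j=1..?r. card (?C (Suc m - j)))"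
    by (simp add: sum.atLeast_Suc_atMost)
  finally show ?thesis .
qed

lemma append_value_Av321:
  assumes "p \<in> Av321 m" "j \<le> num_value_saturated p"
  shows "append_value p (Suc m - j) \<in> Av321 (Suc m)"
  using append_value_Av321_iff[OF assms(1), of "Suc m - j"] assms
    num_value_saturated_le[of p] Av321_length[OF assms(1)] by simp

text \<open>The entry at position \<open>i\<close> stays the maximum as long as no top child is
  entered: every other child raises the value \<open>m\<close> to \<open>Suc m\<close>. Summing over
  these children is the recursion of \<open>stay_count\<close>. An entry that is not the current
  maximum never becomes one.\<close>

lemma card_max_at_position:
  assumes "p \<in> Av321 m" "i < m" "m + n = N"
  shows "card {\<pi> \<in> extensions N p. \<pi> ! i = N} =
    (if p ! i = m then stay_count n (num_value_saturated p) else 0)"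
  using assms
proof (induction n arbitrary: p m)
  case 0
  then have "extensions N p = {p}"
    using prefix_flattening_self Av321_length by (auto simp: extensions_def)
  then show ?case using 0 by (auto simp: Collect_conv_if)
next
  case (Suc n)
  note p = Suc.prems(1)
  have l: "length p = m" using Av321_length[OF p] .
  have im: "p ! i \<le> m" using perm_nth_bounds[OF Av321_perm[OF p] Suc.prems(2)] by simp
  have top: "card {\<pi> \<in> extensions N (append_value p (Suc m)). \<pi> ! i = N} = 0"
    using Suc.IH[OF append_value_Av321[OF p, of 0]] Suc.prems l im
    by (simp add: append_value_nth)
  have "card {\<pi> \<in> extensions N (append_value p (Suc m - j)). \<pi> ! i = N} =
      (if p ! i = m then stay_count n j else 0)"
    if "j \<in> {1..num_value_saturated p}" for j
    using Suc.IH[OF append_value_Av321[OF p, of j]] Suc.prems l im that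
      num_value_saturated_append_below[OF p, of j] num_value_saturated_le[of p]
    by (auto simp: append_value_nth)
  with card_extensions_split[OF p, of N "\<lambda>\<pi>. \<pi> ! i = N"] top Suc.prems show ?case
    by (simp add: stay_count.simps)
qed

section \<open>Winning counts of strategies along the tree\<close>

lemma history_eq:
  assumes "prefix_flattening \<pi> m = q" "i \<le> m"
  shows "history \<pi> i = history q i"
  unfolding history_def using prefix_flattening_prefix_flattening[of _ m \<pi>] assms
  by (auto simp del: upt_Suc)

lemma accepted_step:
  assumes "m < N"
  shows "accepted N m s \<pi> =
    (if s (history \<pi> (Suc m)) \<or> Suc m = N then Suc m else accepted N (Suc m) s \<pi>)"
proof (cases "s (history \<pi> (Suc m)) \<or> Suc m = N")
  case True
  then show ?thesis unfolding accepted_def by (auto intro!: Least_equality)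
next
  case False
  then have "m < i \<and> (s (history \<pi> i) \<or> i = N) \<longleftrightarrow> Suc m < i \<and> (s (history \<pi> i) \<or> i = N)" for i
    by (auto simp: less_Suc_eq le_less Suc_le_eq intro: Suc_lessI)
  then show ?thesis using False by (simp add: accepted_def)
qed

definition win_count :: "nat \<Rightarrow> strategy \<Rightarrow> nat list \<Rightarrow> nat" where
  "win_count N s p = card {\<pi> \<in> extensions N p. \<pi> ! (accepted N (length p) s \<pi> - 1) = N}"

text \<open>
  The wins below the child \<open>q\<close> when the candidates before its last entry are rejected; unlike
  \<open>win_count\<close>, the last entry of \<open>q\<close> itself may be accepted.
\<close>

definition child_count :: "nat \<Rightarrow> strategy \<Rightarrow> nat list \<Rightarrow> nat" where
  "child_count N s q =
    (if s (history q (length q)) \<or> length q = N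
     then if eligible q then stay_count (N - length q) (num_value_saturated q) else 0
     else win_count N s q)"

lemma eligible_append_value: "eligible (append_value p v) \<longleftrightarrow> v = Suc (length p)"
  by (auto simp: eligible_def append_value_def)

text \<open>All extensions of \<open>q\<close> share the history up to the last entry of
  \<open>q\<close>, so the strategy takes the same decision on all of them: either it strikes there,
  or the game restarts one level lower.\<close>

lemma card_child:
  assumes q: "q \<in> Av321 (Suc m)" and "m < N"
  shows "card {\<pi> \<in> extensions N q. \<pi> ! (accepted N m s \<pi> - 1) = N} = child_count N s q"
proof -
  have l: "length q = Suc m" using Av321_length[OF q] .
  have h: "history \<pi> (Suc m) = history q (Suc m)" if "\<pi> \<in> extensions N q" for \<pi>
    using that l by (intro history_eq) (auto simp: extensions_def)
  have "q ! m = last q" using l by (cases q rule: rev_cases) (auto simp: nth_append)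
  then have "q ! m = Suc m \<longleftrightarrow> eligible q" using l by (auto simp: eligible_def)
  then have strike: "card {\<pi> \<in> extensions N q. \<pi> ! m = N} =
      (if eligible q then stay_count (N - Suc m) (num_value_saturated q) else 0)"
    using card_max_at_position[OF q, of m "N - Suc m" N] \<open>m < N\<close> by simp
  show ?thesis
  proof (cases "s (history q (Suc m)) \<or> Suc m = N")
    case True
    then have "{\<pi> \<in> extensions N q. \<pi> ! (accepted N m s \<pi> - 1) = N} =
        {\<pi> \<in> extensions N q. \<pi> ! m = N}"
      using h accepted_step[OF \<open>m < N\<close>] by auto
    then show ?thesis using True strike l by (simp add: child_count_def)
  next
    case False
    then have "{\<pi> \<in> extensions N q. \<pi> ! (accepted N m s \<pi> - 1) = N} =
        {\<pi> \<in> extensions N q. \<pi> ! (accepted N (Suc m) s \<pi> - 1) = N}"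
      using h accepted_step[OF \<open>m < N\<close>] by auto
    then show ?thesis using False l by (simp add: child_count_def win_count_def)
  qed
qed

lemma win_count_rec:
  assumes p: "p \<in> Av321 m" and "m < N"
  shows "win_count N s p = child_count N s (append_value p (Suc m)) +
    (\<Sum>j=1..num_value_saturated p. child_count N s (append_value p (Suc m - j)))"
proof -
  have "card {\<pi> \<in> extensions N (append_value p (Suc m - j)). \<pi> ! (accepted N m s \<pi> - 1) = N}
      = child_count N s (append_value p (Suc m - j))" if "j \<le> num_value_saturated p" for j
    using that assms by (intro card_child append_value_Av321)
  from this this[of 0] show ?thesis
    unfolding win_count_def Av321_length[OF p] card_extensions_split[OF assms] by simp
qed

text \<open>Only the top child is eligible, so accepting at any other child wins nothing and
  continuing there is at least as good. With one candidate left acceptance is forced, which is why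
  the induction starts at \<open>Suc 0\<close>.\<close>

lemma win_count_le_best_count:
  assumes "p \<in> Av321 m" "m + Suc n = N"
  shows "win_count N s p \<le> best_count (Suc n) (num_value_saturated p)"
  using assms
proof (induction n arbitrary: p m)
  case 0
  note p = 0(1)
  have l: "length p = m" using Av321_length[OF p] .
  have below: "child_count N s (append_value p (Suc m - j)) = 0" if "1 \<le> j" for j
    using that 0 l by (simp add: child_count_def eligible_append_value)
  have "child_count N s (append_value p (Suc m)) \<le> 1"
    using 0 l by (simp add: child_count_def)
  with below show ?case
    using 0 win_count_rec[OF p, of N s] by (simp add: best_count.simps)
next
  case (Suc n)
  note p = Suc.prems(1)
  have l: "length p = m" using Av321_length[OF p] .
  have IH: "win_count N s (append_value p (Suc m - j)) \<le>
      best_count (Suc n) (num_value_saturated (append_value p (Suc m - j)))"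
    if "j \<le> num_value_saturated p" for j
    using that Suc.prems append_value_Av321[OF p] by (intro Suc.IH) auto
  have top: "child_count N s (append_value p (Suc m)) \<le>
      max (stay_count (Suc n) (Suc (num_value_saturated p)))
        (best_count (Suc n) (Suc (num_value_saturated p)))"
    using IH[of 0] num_value_saturated_append_top[OF p] l Suc.prems
    by (auto simp: child_count_def le_max_iff_disj)
  have below: "child_count N s (append_value p (Suc m - j)) \<le> best_count (Suc n) j"
    if "j \<in> {1..num_value_saturated p}" for j
    using that IH[of j] num_value_saturated_append_below[OF p, of j] l Suc.prems
    by (auto simp: child_count_def eligible_append_value)
  show ?case
    unfolding best_count.simps(2)[of "Suc n"]
    using win_count_rec[OF p, of N s] Suc.prems
      add_mono[OF top sum_mono[of "{1..num_value_saturated p}", OF below]] by simp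
qed

text \<open>Ties between striking and continuing may be broken either way.\<close>

lemma win_count_eq_best_count:
  assumes "p \<in> Av321 m" "m + Suc n = N"
    and elig: "\<And>q. sel q \<Longrightarrow> eligible q"
    and sel: "\<And>q. \<lbrakk>q \<in> Av321 (length q); sel q; length q < N\<rbrakk> \<Longrightarrow>
      best_count (N - length q) (num_value_saturated q)
        \<le> stay_count (N - length q) (num_value_saturated q)"
    and nsel: "\<And>q. \<lbrakk>q \<in> Av321 (length q); eligible q; \<not> sel q; length q < N\<rbrakk> \<Longrightarrow>
      stay_count (N - length q) (num_value_saturated q)
        \<le> best_count (N - length q) (num_value_saturated q)"
  shows "win_count N (\<lambda>h. sel (last h)) p = best_count (Suc n) (num_value_saturated p)"
  using assms(1,2)
proof (induction n arbitrary: p m)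
  case 0
  note p = 0(1)
  have l: "length p = m" using Av321_length[OF p] .
  let ?s = "\<lambda>h. sel (last h)"
  have below: "child_count N ?s (append_value p (Suc m - j)) = 0" if "1 \<le> j" for j
    using that 0 l by (simp add: child_count_def eligible_append_value)
  have "child_count N ?s (append_value p (Suc m)) = 1"
    using 0 l by (simp add: child_count_def eligible_append_value)
  with below show ?case
    using 0 win_count_rec[OF p, of N ?s] by (simp add: best_count.simps)
next
  case (Suc n)
  note p = Suc.prems(1)
  let ?s = "\<lambda>h. sel (last h)"
  have l: "length p = m" using Av321_length[OF p] .
  have n: "N - Suc m = Suc n" "Suc m < N" using Suc.prems by auto
  have q: "append_value p (Suc m - j) \<in> Av321 (Suc m)" if "j \<le> num_value_saturated p" for j
    using that by (rule append_value_Av321[OF p])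
  have IH: "win_count N ?s (append_value p (Suc m - j)) =
      best_count (Suc n) (num_value_saturated (append_value p (Suc m - j)))"
    if "j \<le> num_value_saturated p" for j
    using that Suc.prems q by (intro Suc.IH) auto
  have lasth: "last (history q (length q)) = q" if "q \<in> Av321 (Suc m)" for q
    using prefix_flattening_self[OF that] Av321_length[OF that] by (simp add: history_def)
  have q0: "append_value p (Suc m) \<in> Av321 (Suc m)" using q[of 0] by simp
  have top: "child_count N ?s (append_value p (Suc m)) =
      max (stay_count (Suc n) (Suc (num_value_saturated p)))
        (best_count (Suc n) (Suc (num_value_saturated p)))"
    using IH[of 0] num_value_saturated_append_top[OF p] l n lasth[OF q0] q0
      sel[of "append_value p (Suc m)"] nsel[of "append_value p (Suc m)"]
    by (auto simp: child_count_def eligible_append_value max_def)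
  have below: "child_count N ?s (append_value p (Suc m - j)) = best_count (Suc n) j"
    if j: "j \<in> {1..num_value_saturated p}" for j
  proof -
    \<comment> \<open>Only eligible prefixes are struck, so no acceptance is wasted on a child below
      the top.\<close>
    have "\<not> sel (append_value p (Suc m - j))"
      using elig[of "append_value p (Suc m - j)"] j l by (auto simp: eligible_append_value)
    then show ?thesis
      using j IH[of j] num_value_saturated_append_below[OF p, of j] l n lasth[OF q[of j]]
      by (simp add: child_count_def)
  qed
  have "win_count N ?s p = child_count N ?s (append_value p (Suc m)) +
      (\<Sum>j=1..num_value_saturated p. child_count N ?s (append_value p (Suc m - j)))"
    using n by (intro win_count_rec[OF p]) simp
  also have "\<dots> = best_count (Suc (Suc n)) (num_value_saturated p)"
    unfolding best_count.simps(2)[of "Suc n"] top using below by simp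
  finally show ?case .
qed

section \<open>The threshold strategy\<close>

lemma length_increasing_perm [simp]: "length (increasing_perm k) = k"
  by (simp add: increasing_perm_def del: upt_Suc)

lemma increasing_perm_nth: "i < k \<Longrightarrow> increasing_perm k ! i = Suc i"
  by (simp add: increasing_perm_def del: upt_Suc)

lemma increasing_perm_Av321: "increasing_perm k \<in> Av321 k"
  using increasing_perm_in_Av321_under[of k k] by (simp add: Av321_under_def)

lemma Av321_under_eq: "Av321_under N k = extensions N (increasing_perm k)"
  by (simp add: Av321_under_def extensions_def)

text \<open>Every parameter is thus realised by an increasing prefix, so that the games under these
  prefixes decide the comparison at all nodes.\<close>

lemma num_value_saturated_increasing_perm: "num_value_saturated (increasing_perm k) = k"
proof (rule num_value_saturated_eqI)
  fix v assume "length (increasing_perm k) - k < v" "v \<le> length (increasing_perm k)"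
  then show "is_ltr_max_value (increasing_perm k) v"
    unfolding is_ltr_max_value_def
    by (intro exI[of _ "v - 1"]) (auto simp: increasing_perm_nth)
qed simp_all

text \<open>The largest value is always a left-to-right maximum. This excludes the parameter 0, to
  which the ratio comparison does not extend.\<close>

lemma num_value_saturated_pos:
  assumes "p \<in> Av321 m" "1 \<le> m"
  shows "1 \<le> num_value_saturated p"
proof -
  note perm = Av321_perm[OF assms(1)]
  obtain b where b: "b < m" "p ! b = m" using perm_value_obtain[OF perm, of m] assms by auto
  have "p ! a < p ! b" if "a < b" for a
    using that b perm_nth_bounds[OF perm, of a] Av321_length[OF assms(1)] perm
      nth_eq_iff_index_eq[of p a b]
    by (auto simp: permutations_of_set_def le_less)
  then have "is_ltr_max_value p m" using is_ltr_max_value_nth[OF perm, of b] b by simp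
  then show ?thesis
    using num_value_saturated_max[of p] Av321_length[OF assms(1)] assms(2)
    by (cases "num_value_saturated p = 0") auto
qed

lemma Av321_under_nonempty: "k \<le> N \<Longrightarrow> Av321_under N k \<noteq> {}"
  using increasing_perm_in_Av321_under by blast

lemma win_prob_eq:
  assumes "k \<le> N"
  shows "win_prob N k s =
    real (win_count N s (increasing_perm k)) / real (card (Av321_under N k))"
proof -
  have "Av321_under N k \<inter> {\<pi>. \<pi> ! (accepted N k s \<pi> - 1) = N} =
      {\<pi> \<in> extensions N (increasing_perm k).
        \<pi> ! (accepted N (length (increasing_perm k)) s \<pi> - 1) = N}"
    by (auto simp: Av321_under_eq)
  then show ?thesis
    by (simp add: win_prob_def win_count_def
        measure_pmf_of_set[OF Av321_under_nonempty[OF assms] finite_Av321_under])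
qed

text \<open>The upper bound on win counts is attained by the strategy that strikes at an eligible
  prefix exactly when striking is at least as good as continuing. It is defined by the counts and
  not by \<open>threshold\<close>, which itself rests on \<open>max_win_prob\<close>.\<close>

lemma max_win_prob_eq:
  assumes "k < N"
  shows "max_win_prob N k = real (best_count (N - k) k) / real (card (Av321_under N k))"
proof -
  obtain n where n: "k + Suc n = N" using assms less_iff_Suc_add by auto
  define s :: strategy where "s = (\<lambda>h. (\<lambda>q. eligible q \<and>
    best_count (N - length q) (num_value_saturated q)
      \<le> stay_count (N - length q) (num_value_saturated q)) (last h))"
  have "win_count N s (increasing_perm k) = best_count (Suc n) (num_value_saturated (increasing_perm k))"
    unfolding s_def by (rule win_count_eq_best_count[OF increasing_perm_Av321 n]) auto
  moreover have "N - k = Suc n" using n by simp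
  ultimately have "win_prob N k s = real (best_count (N - k) k) / real (card (Av321_under N k))"
    using assms by (simp add: win_prob_eq num_value_saturated_increasing_perm)
  moreover have "win_prob N k t \<le> real (best_count (N - k) k) / real (card (Av321_under N k))" for t
    using win_count_le_best_count[OF increasing_perm_Av321 n, of t] assms \<open>N - k = Suc n\<close>
    by (simp add: win_prob_eq num_value_saturated_increasing_perm divide_right_mono)
  ultimately show ?thesis
    unfolding max_win_prob_def using assms
    by (intro Max_eqI finite_range_win_prob) (auto intro: range_eqI[of _ _ s])
qed

section \<open>Identification of the threshold\<close>

lemma strike_prob_eq:
  assumes "1 \<le> j"
  shows "strike_prob (j + i) j = real (stay_count i j) / real (card (Av321_under (j + i) j))"
proof -
  have "Av321_under (j + i) j \<inter> {\<pi>. \<pi> ! (j - 1) = j + i} =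
      {\<pi> \<in> extensions (j + i) (increasing_perm j). \<pi> ! (j - 1) = j + i}"
    by (auto simp: Av321_under_eq)
  moreover have "increasing_perm j ! (j - 1) = j"
    using assms by (simp add: increasing_perm_nth)
  moreover have "Av321_under (j + i) j \<noteq> {}" by (intro Av321_under_nonempty) simp
  ultimately show ?thesis
    using card_max_at_position[OF increasing_perm_Av321, of "j - 1" j i "j + i"] assms
    by (simp add: strike_prob_def measure_pmf_of_set finite_Av321_under
        num_value_saturated_increasing_perm)
qed

lemma optimal_pair_iff:
  assumes "1 \<le> j"
  shows "optimal_pair (j + i) j \<longleftrightarrow> best_count i j < stay_count i j"
proof -
  have "closed_best_prob (j + i) j =
      real (best_count i j) / real (card (Av321_under (j + i) j))"
    \<comment> \<open>For \<open>i = 0\<close> no candidate remains, and the convention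
      \<open>closed_best_prob j j = 0\<close> agrees with \<open>best_count 0 j = 0\<close>.\<close>
    using max_win_prob_eq[of j "j + i"] by (cases i) (simp_all add: closed_best_prob_def)
  moreover have "0 < card (Av321_under (j + i) j)"
    using Av321_under_nonempty[of j "j + i"] finite_Av321_under by (simp add: card_gt_0_iff)
  ultimately show ?thesis
    by (simp add: optimal_pair_def strike_prob_eq[OF assms] divide_less_cancel)
qed

text \<open>The threshold is the least optimal parameter, and by \<open>stay_beats_best_mono\<close>
  the optimal parameters are closed upwards.\<close>

lemma threshold_le_iff:
  assumes "1 \<le> r"
  shows "threshold i \<le> enat r \<longleftrightarrow> best_count i r < stay_count i r"
proof
  assume "best_count i r < stay_count i r"
  then have "1 \<le> r \<and> optimal_pair (r + i) r" using assms optimal_pair_iff by blast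
  then show "threshold i \<le> enat r" unfolding threshold_def by (auto intro: Least_le)
next
  assume le: "threshold i \<le> enat r"
  then have ex: "\<exists>j. 1 \<le> j \<and> optimal_pair (j + i) j"
    by (auto simp: threshold_def split: if_splits)
  define j where "j = (LEAST j. 1 \<le> j \<and> optimal_pair (j + i) j)"
  have "1 \<le> j \<and> optimal_pair (j + i) j" unfolding j_def by (rule LeastI_ex[OF ex])
  moreover have "j \<le> r" using le ex by (auto simp: threshold_def j_def)
  ultimately show "best_count i r < stay_count i r"
    using stay_beats_best_mono[of j r i] optimal_pair_iff by blast
qed

text \<open>A strategy that repeats only the first strike of \<open>t\<close> accepts the same
  candidate. This removes the minimality clause of the strike set.\<close>

lemma accepted_first:
  assumes "k < N"
    and iff: "\<And>i. k < i \<Longrightarrow> i \<le> N \<Longrightarrow>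
      s (history \<pi> i) \<longleftrightarrow> t (history \<pi> i) \<and> (\<forall>j. k < j \<and> j < i \<longrightarrow> \<not> t (history \<pi> j))"
  shows "accepted N k s \<pi> = accepted N k t \<pi>"
proof -
  let ?P = "\<lambda>i. k < i \<and> (t (history \<pi> i) \<or> i = N)"
  let ?a = "accepted N k t \<pi>"
  have a: "?P ?a" unfolding accepted_def by (rule LeastI[of _ N]) (use assms in simp)
  have least: "?a \<le> i" if "?P i" for i unfolding accepted_def using that by (rule Least_le)
  have "?a \<le> N" using assms by (intro least) simp
  show ?thesis unfolding accepted_def[of _ _ s]
  proof (rule Least_equality)
    show "k < ?a \<and> (s (history \<pi> ?a) \<or> ?a = N)"
      using a iff[of ?a] least \<open>?a \<le> N\<close> by (auto simp: not_le[symmetric])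
  next
    fix i assume "k < i \<and> (s (history \<pi> i) \<or> i = N)"
    then show "?a \<le> i" using iff[of i] least[of i] \<open>?a \<le> N\<close> by (cases "i \<le> N") auto
  qed
qed

theorem theorem4p8:
  fixes N k :: nat
  assumes "1 \<le> N" and "1 \<le> k" and "k \<le> N - 1"
  shows "optimal_strike_set N k (threshold_strike_set N k)"
proof -
  have "k < N" using assms by simp
  then obtain n where n: "k + Suc n = N" using less_iff_Suc_add by auto
  \<comment> \<open>The strike condition without minimality; unlike membership in \<open>A\<close>,
    it depends on the current prefix alone.\<close>
  define sel where "sel q \<longleftrightarrow> eligible q \<and> selected_by_threshold N q" for q
  define A where "A = threshold_strike_set N k"
  let ?s = "strike_strategy A" and ?t = "\<lambda>h. sel (last h)"
  have last_history: "last (history \<pi> i) = prefix_flattening \<pi> i" if "1 \<le> i" for \<pi> i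
    using that by (simp add: history_def)
  have "accepted N k ?s \<pi> = accepted N k ?t \<pi>" if \<pi>: "\<pi> \<in> extensions N (increasing_perm k)" for \<pi>
  proof (rule accepted_first[OF \<open>k < N\<close>])
    fix i assume i: "k < i" "i \<le> N"
    have \<pi>N: "\<pi> \<in> Av321 N" and \<pi>k: "prefix_flattening \<pi> k = increasing_perm k"
      using \<pi> by (auto simp: extensions_def)
    have "length (prefix_flattening \<pi> i) = i"
      using Av321_length[OF prefix_flattening_Av321[OF \<pi>N i(2)]] .
    moreover have "prefix_flattening \<pi> i \<in> prefixes N"
      using \<pi>N i by (auto simp: prefixes_def intro!: exI[of _ \<pi>] exI[of _ i])
    ultimately show "?s (history \<pi> i) \<longleftrightarrow>
        ?t (history \<pi> i) \<and> (\<forall>j. k < j \<and> j < i \<longrightarrow> \<not> ?t (history \<pi> j))"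
      using i \<pi>k
      by (auto simp: strike_strategy_def A_def threshold_strike_set_def sel_def last_history
          prefix_flattening_prefix_flattening)
  qed
  then have "win_count N ?s (increasing_perm k) = win_count N ?t (increasing_perm k)"
    unfolding win_count_def by (intro arg_cong[where f = card]) auto
  also have "\<dots> = best_count (Suc n) (num_value_saturated (increasing_perm k))"
  proof (rule win_count_eq_best_count[OF increasing_perm_Av321 n])
    fix q assume q: "q \<in> Av321 (length q)"
    \<comment> \<open>An eligible prefix is nonempty and so has a positive parameter. The strict
      inequality means that the threshold resolves ties by continuing.\<close>
    have iff: "selected_by_threshold N q \<longleftrightarrow> best_count (N - length q) (num_value_saturated q)
        < stay_count (N - length q) (num_value_saturated q)" if "eligible q"
      unfolding selected_by_threshold_def
      using num_value_saturated_pos[OF q] that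
      by (intro threshold_le_iff) (auto simp: eligible_def Suc_le_eq)
    show "best_count (N - length q) (num_value_saturated q)
        \<le> stay_count (N - length q) (num_value_saturated q)" if "sel q"
      using iff that by (simp add: sel_def)
    show "stay_count (N - length q) (num_value_saturated q)
        \<le> best_count (N - length q) (num_value_saturated q)" if "eligible q" "\<not> sel q"
      using iff that by (simp add: sel_def)
  qed (simp add: sel_def)
  finally have "win_count N ?s (increasing_perm k) = best_count (N - k) k"
    using n by (simp add: num_value_saturated_increasing_perm flip: n)
  then show ?thesis
    using \<open>k < N\<close> by (simp add: optimal_strike_set_def A_def win_prob_eq max_win_prob_eq)
qed

end
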